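(* Let $n\ge1$, let $K_0\subset\cdots\subset K_n$ be a tower of subfields (equalities allowed) of a finite field $K=\mathbb{F}_q$, let $d_i=|K_i|$, and let $\mathcal{X}=[K_0\times\cdots\times K_n]\subset\mathbb{P}^n$. Put $m_n=\min\{m\in\mathbb{N}: m(d_n-1)>\sum_{i=1}^{n-1}(d_i-1)\}$. Then $\mathcal{X}$ is Cayley--Bacharach if and only if $$\sum_{i=1}^n(d_i-1)+1=m_n(d_n-1)+1.$$
   Context: $S=K[t_0,\ldots,t_n]=\bigoplus_{d\ge0}S_d$ has the standard grading, and $\mathbb{P}^n$ is projective space over $K$. $\mathcal{X}=[K_0\times\cdots\times K_n]:=\{(a_0:\cdots:a_n)\in\mathbb{P}^n: a_i\in K_i\text{ for all }i\}$. $I_{\mathcal X}\subset S$ is the ideal generated by the homogeneous polynomials vanishing on $\mathcal{X}$; $H_{\mathcal X}(d):=\dim_K(S_d/(I_{\mathcal X}\cap S_d))$; and $\mathrm{reg}(H_{\mathcal X})$ is the least $r\ge0$ with $H_{\mathcal X}(d)=|\mathcal X|$ for all $d\ge r$. $\mathcal{X}$ is called Cayley--Bacharach if every hypersurface (zero set of a form in $S$) of degree less than $\mathrm{reg}(H_{\mathcal X})$ which contains all but one point of $\mathcal{X}$ must contain all points of $\mathcal{X}$. Equivalently, $\mathrm{v}_P(I_{\mathcal X})=\mathrm{reg}(H_{\mathcal X})$ for all $P\in\mathcal{X}$, where $\mathrm{v}_P(I_{\mathcal X})$ is the least degree of a homogeneous $f\in S$ with $f(P)\neq 0$ and $f(Q)=0$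 for all $Q\in\mathcal{X}\setminus\{P\}$. Empty sums are $0$. *)

theory Defs
  imports "HOL.Hull" "HOL-Library.Poly_Mapping"
begin

section \<open>The graded polynomial ring\<close>

text \<open>Polynomials in the variables \<open>t_0, t_1, \<dots>\<close>: finitely supported maps from exponent
  vectors to coefficients, with the convolution product of the library.\<close>

type_synonym 'a mpoly = "(nat \<Rightarrow>\<^sub>0 nat) \<Rightarrow>\<^sub>0 'a"

definition poly_ring :: "nat \<Rightarrow> 'a::field mpoly set" where
  "poly_ring n = {f. \<forall>m\<in>Poly_Mapping.keys f. Poly_Mapping.keys m \<subseteq> {..n}}"

definition mon_degree :: "(nat \<Rightarrow>\<^sub>0 nat) \<Rightarrow> nat" where
  "mon_degree m = (\<Sum>i\<in>Poly_Mapping.keys m. Poly_Mapping.lookup m i)"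

text \<open>The graded piece \<open>S_d\<close>; it contains the zero polynomial for every \<open>d\<close>.\<close>

definition forms :: "nat \<Rightarrow> nat \<Rightarrow> 'a::field mpoly set" where
  "forms n d = {f \<in> poly_ring n. \<forall>m\<in>Poly_Mapping.keys f. mon_degree m = d}"

definition scale_poly :: "'a::field \<Rightarrow> 'a mpoly \<Rightarrow> 'a mpoly" where
  "scale_poly c f = Poly_Mapping.single 0 c * f"

definition eval_poly :: "'a::field mpoly \<Rightarrow> (nat \<Rightarrow> 'a) \<Rightarrow> 'a" where
  "eval_poly f a = (\<Sum>m\<in>Poly_Mapping.keys f. Poly_Mapping.lookup f m *
      (\<Prod>i\<in>Poly_Mapping.keys m. a i ^ Poly_Mapping.lookup m i))"

definition is_ideal :: "nat \<Rightarrow> 'a::field mpoly set \<Rightarrow> bool" where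
  "is_ideal n I \<longleftrightarrow> I \<subseteq> poly_ring n \<and> 0 \<in> I \<and> (\<forall>f\<in>I. \<forall>g\<in>I. f + g \<in> I) \<and>
      (\<forall>h\<in>poly_ring n. \<forall>f\<in>I. h * f \<in> I)"

section \<open>Projective space\<close>

text \<open>Vectors of \<open>K\<^sup>n\<^sup>+\<^sup>1\<close> are functions on \<open>nat\<close> that vanish beyond \<open>n\<close>, so that equality
  of vectors is equality of functions.\<close>

definition nonzero_vecs :: "nat \<Rightarrow> (nat \<Rightarrow> 'a::field) set" where
  "nonzero_vecs n = {a. (\<forall>i>n. a i = 0) \<and> (\<exists>i\<le>n. a i \<noteq> 0)}"

definition proj_rel :: "nat \<Rightarrow> ((nat \<Rightarrow> 'a::field) \<times> (nat \<Rightarrow> 'a)) set" where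
  "proj_rel n = {(a, b). a \<in> nonzero_vecs n \<and> b \<in> nonzero_vecs n \<and>
      (\<exists>c. c \<noteq> 0 \<and> (\<forall>i. b i = c * a i))}"

definition proj_space :: "nat \<Rightarrow> (nat \<Rightarrow> 'a::field) set set" where
  "proj_space n = nonzero_vecs n // proj_rel n"

text \<open>The set \<open>[K_0 \<times> \<cdots> \<times> K_n]\<close>: a point belongs to it as soon as some representative has
  its coordinates in the prescribed sets.\<close>

definition proj_nested :: "nat \<Rightarrow> (nat \<Rightarrow> 'a::field set) \<Rightarrow> (nat \<Rightarrow> 'a) set set" where
  "proj_nested n K = {P \<in> proj_space n. \<exists>a\<in>P. \<forall>i\<le>n. a i \<in> K i}"

text \<open>Used only for homogeneous \<open>f\<close>, where it does not depend on the representative.\<close>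

definition vanishes_at :: "'a::field mpoly \<Rightarrow> (nat \<Rightarrow> 'a) set \<Rightarrow> bool" where
  "vanishes_at f P \<longleftrightarrow> (\<forall>a\<in>P. eval_poly f a = 0)"

definition hypersurface :: "nat \<Rightarrow> 'a::field mpoly \<Rightarrow> (nat \<Rightarrow> 'a) set set" where
  "hypersurface n f = {P \<in> proj_space n. vanishes_at f P}"

definition vanishing_ideal :: "nat \<Rightarrow> (nat \<Rightarrow> 'a::field) set set \<Rightarrow> 'a mpoly set" where
  "vanishing_ideal n X = (is_ideal n) hull {f. \<exists>d. f \<in> forms n d \<and> (\<forall>P\<in>X. vanishes_at f P)}"

section \<open>Dimension of a quotient space\<close>

text \<open>\<open>B\<close> is a set of representatives of a basis of \<open>V / W\<close>: the residue classes of the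
  elements of \<open>B\<close> are distinct, linearly independent, and span \<open>V / W\<close>.\<close>

definition basis_mod :: "('k::field \<Rightarrow> 'v::ab_group_add \<Rightarrow> 'v) \<Rightarrow> 'v set \<Rightarrow> 'v set \<Rightarrow> 'v set \<Rightarrow> bool" where
  "basis_mod scale V W B \<longleftrightarrow> finite B \<and> B \<subseteq> V \<and>
      (\<forall>u. (\<Sum>b\<in>B. scale (u b) b) \<in> W \<longrightarrow> (\<forall>b\<in>B. u b = 0)) \<and>
      (\<forall>v\<in>V. \<exists>u. v - (\<Sum>b\<in>B. scale (u b) b) \<in> W)"

definition quotient_dim :: "('k::field \<Rightarrow> 'v::ab_group_add \<Rightarrow> 'v) \<Rightarrow> 'v set \<Rightarrow> 'v set \<Rightarrow> nat" where
  "quotient_dim scale V W = (THE k. \<exists>B. basis_mod scale V W B \<and> card B = k)"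

section \<open>Hilbert function and the Cayley--Bacharach property\<close>

definition hilbert_fun :: "nat \<Rightarrow> (nat \<Rightarrow> 'a::field) set set \<Rightarrow> nat \<Rightarrow> nat" where
  "hilbert_fun n X d = quotient_dim scale_poly (forms n d) (vanishing_ideal n X \<inter> forms n d)"

definition hilbert_reg :: "nat \<Rightarrow> (nat \<Rightarrow> 'a::field) set set \<Rightarrow> nat" where
  "hilbert_reg n X = (LEAST r. \<forall>d\<ge>r. hilbert_fun n X d = card X)"

definition cayley_bacharach :: "nat \<Rightarrow> (nat \<Rightarrow> 'a::field) set set \<Rightarrow> bool" where
  "cayley_bacharach n X \<longleftrightarrow>
    (\<forall>d<hilbert_reg n X. \<forall>f\<in>forms n d. f \<noteq> 0 \<longrightarrow>
      (\<forall>P\<in>X. X - {P} \<subseteq> hypersurface n f \<longrightarrow> X \<subseteq> hypersurface n f))"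

section \<open>Subfields\<close>

definition is_subfield :: "'a::field set \<Rightarrow> bool" where
  "is_subfield F \<longleftrightarrow> 0 \<in> F \<and> 1 \<in> F \<and> (\<forall>x\<in>F. \<forall>y\<in>F. x - y \<in> F \<and> x * y \<in> F) \<and>
      (\<forall>x\<in>F. inverse x \<in> F)"

end

theory Submission
  imports Defs "HOL-Library.FuncSet" "HOL-Computational_Algebra.Polynomial"
begin

text \<open>Every point of \<open>X\<close> has a unique representative whose first nonzero coordinate is \<open>1\<close>. Put
  \<open>s = \<Sum>\<^sub>i\<^sub>=\<^sub>1\<^sup>n (d\<^sub>i - 1)\<close>. Induction on \<open>n\<close> shows that forms of each degree above \<open>s\<close> interpolate arbitrary
  values on \<open>X\<close>; the point \<open>(0 : \<dots> : 0 : 1)\<close> is even separated from the others in degree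
  \<open>m (d\<^sub>n - 1) + 1 \<le> s + 1\<close>, because interpolation on the first \<open>n\<close> coordinates is possible
  in degree \<open>m (d\<^sub>n - 1)\<close>.

  In the other direction, a power sum of exponent less than \<open>d\<^sub>i - 1\<close> over \<open>K\<^sub>i\<close> vanishes. Hence the sums
  of a form of degree \<open>s\<close> over \<open>{1} \<times> K\<^sub>1 \<times> \<dots> \<times> K\<^sub>n\<close> and over \<open>{0} \<times> K\<^sub>1 \<times> \<dots> \<times> K\<^sub>n\<close> agree, so
  that no such form separates \<open>(1 : 0 : \<dots> : 0)\<close>, and the regularity is \<open>s + 1\<close>. The
  Cayley--Bacharach property therefore forces \<open>s = m (d\<^sub>n - 1)\<close>. Conversely, if \<open>d\<^sub>n - 1\<close>
  divides \<open>s\<close>, a form of degree \<open>s\<close> is constant on the representatives in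
  \<open>K\<^sub>0 \<times> \<dots> \<times> K\<^sub>n\<close> of each point, so the vanishing of its sum over this box says that its values at the
  normalised representatives sum to \<open>0\<close>.\<close>

section \<open>Power sums over finite subfields\<close>

lemma subfield_zero: "is_subfield F \<Longrightarrow> 0 \<in> F"
  and subfield_one: "is_subfield F \<Longrightarrow> 1 \<in> F"
  and subfield_diff: "is_subfield F \<Longrightarrow> x \<in> F \<Longrightarrow> y \<in> F \<Longrightarrow> x - y \<in> F"
  and subfield_mult: "is_subfield F \<Longrightarrow> x \<in> F \<Longrightarrow> y \<in> F \<Longrightarrow> x * y \<in> F"
  and subfield_inverse: "is_subfield F \<Longrightarrow> x \<in> F \<Longrightarrow> inverse x \<in> F"
  by (auto simp: is_subfield_def)

lemma subfield_add:
  assumes "is_subfield F" "x \<in> F" "y \<in> F"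
  shows "x + y \<in> F"
  using subfield_diff[OF assms(1,2) subfield_diff[OF assms(1) subfield_zero[OF assms(1)] assms(3)]]
  by simp

lemma subfield_divide:
  assumes "is_subfield F" "x \<in> F" "y \<in> F"
  shows "x / y \<in> F"
  using subfield_mult[OF assms(1,2) subfield_inverse[OF assms(1,3)]]
  by (simp add: divide_inverse)

context
  fixes F :: "'a::{field,finite} set"
  assumes F: "is_subfield F"
begin

lemma subfield_card_ge_2: "card F \<ge> 2"
proof -
  have "card {0, 1::'a} \<le> card F"
    using F by (intro card_mono) (auto simp: subfield_zero subfield_one)
  then show ?thesis by simp
qed

text \<open>Translation by \<open>1\<close> permutes \<open>F\<close>; comparing the sum over
  \<open>F\<close> with the sum over its translate leaves
  \<open>of_nat (card F) = 0\<close>.\<close>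

lemma subfield_of_nat_card: "of_nat (card F) = (0::'a)"
proof -
  have "(\<Sum>x\<in>F. x) = (\<Sum>x\<in>F. x + 1)"
    by (rule sum.reindex_bij_witness[of _ "\<lambda>x. x + 1" "\<lambda>x. x - 1"])
       (auto intro: F subfield_add subfield_diff subfield_one)
  then show ?thesis by (simp add: sum.distrib)
qed

lemma subfield_scale_bij:
  assumes "y \<in> F" "y \<noteq> 0"
  shows "bij_betw ((*) y) F F" "bij_betw ((*) y) (F - {0}) (F - {0})"
  by (rule bij_betw_byWitness[of _ "\<lambda>x. x / y"];
      use assms F in \<open>auto intro: subfield_mult subfield_divide\<close>)+

text \<open>Lagrange for the group of units: multiplication by \<open>y\<close> permutes the nonzero
  elements, and their product is nonzero, so it cancels.\<close>

lemma subfield_power_card: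
  assumes y: "y \<in> F" "y \<noteq> 0"
  shows "y ^ (card F - 1) = 1"
proof -
  have "(\<Prod>x\<in>F-{0}. x) = (\<Prod>x\<in>F-{0}. y * x)"
    by (rule prod.reindex_bij_betw[OF subfield_scale_bij(2)[OF y], symmetric])
  also have "\<dots> = y ^ (card F - 1) * (\<Prod>x\<in>F-{0}. x)"
    by (simp add: prod.distrib card_Diff_singleton F subfield_zero)
  finally show ?thesis by simp
qed

text \<open>For positive \<open>e\<close> some unit \<open>y\<close> has
  \<open>y ^ e \<noteq> 1\<close>, and replacing \<open>x\<close> by \<open>y * x\<close> multiplies
  the sum by \<open>y ^ e\<close>. For \<open>e = 0\<close> the convention \<open>0 ^ 0 = 1\<close>
  turns the sum into \<open>card F\<close>, which is zero in the field.\<close>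

lemma subfield_power_sum:
  assumes e: "e < card F - 1"
  shows "(\<Sum>x\<in>F. x ^ e) = 0"
proof (cases "e = 0")
  case True
  then show ?thesis by (simp add: subfield_of_nat_card)
next
  case False
  \<comment> \<open>This polynomial has at most \<open>e\<close> roots, fewer than \<open>F\<close>
    has units, so some unit is not a root.\<close>
  define p :: "'a poly" where "p = monom 1 e - 1"
  have deg: "degree p \<le> e"
    unfolding p_def by (intro degree_diff_le degree_monom_le) auto
  have "coeff p e \<noteq> 0"
    using False by (simp add: p_def)
  then have "p \<noteq> 0" by auto
  then have "card {x. poly p x = 0} < card (F - {0})"
    using card_poly_roots_bound[of p] deg e by (simp add: card_Diff_singleton F subfield_zero)
  then have "\<not> F - {0} \<subseteq> {x. poly p x = 0}"
    by (meson card_mono finite leD)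
  then obtain y where y: "y \<in> F" "y \<noteq> 0" "y ^ e \<noteq> 1"
    by (auto simp: p_def poly_monom)
  have "(\<Sum>x\<in>F. x ^ e) = (\<Sum>x\<in>F. (y * x) ^ e)"
    by (rule sum.reindex_bij_betw[OF subfield_scale_bij(1)[OF y(1,2)], symmetric])
  also have "\<dots> = y ^ e * (\<Sum>x\<in>F. x ^ e)"
    by (simp add: power_mult_distrib sum_distrib_left)
  finally show ?thesis using y(3) by simp
qed

end

section \<open>Evaluation of polynomials\<close>

definition eval_monom :: "(nat \<Rightarrow>\<^sub>0 nat) \<Rightarrow> (nat \<Rightarrow> 'a::field) \<Rightarrow> 'a" where
  "eval_monom m a = (\<Prod>i\<in>Poly_Mapping.keys m. a i ^ Poly_Mapping.lookup m i)"

text \<open>Exponents off the support contribute factors \<open>1\<close>, so monomials with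
  different supports can be compared over one index set.\<close>

lemma eval_monom_superset:
  assumes "finite A" "Poly_Mapping.keys m \<subseteq> A"
  shows "eval_monom m a = (\<Prod>i\<in>A. a i ^ Poly_Mapping.lookup m i)"
  unfolding eval_monom_def
  by (rule prod.mono_neutral_left) (use assms in \<open>auto simp: in_keys_iff\<close>)

lemma mon_degree_superset:
  assumes "finite A" "Poly_Mapping.keys m \<subseteq> A"
  shows "mon_degree m = (\<Sum>i\<in>A. Poly_Mapping.lookup m i)"
  unfolding mon_degree_def
  by (rule sum.mono_neutral_left) (use assms in \<open>auto simp: in_keys_iff\<close>)

lemma eval_monom_add: "eval_monom (m + m') a = eval_monom m a * eval_monom m' a"
proof -
  define A where "A = Poly_Mapping.keys m \<union> Poly_Mapping.keys m'"
  have A: "finite A" "Poly_Mapping.keys (m + m') \<subseteq> A" "Poly_Mapping.keys m \<subseteq> A"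
      "Poly_Mapping.keys m' \<subseteq> A"
    using Poly_Mapping.keys_add[of m m'] by (auto simp: A_def)
  show ?thesis
    by (simp add: eval_monom_superset[OF A(1,2)] eval_monom_superset[OF A(1,3)]
        eval_monom_superset[OF A(1,4)] lookup_add power_add prod.distrib)
qed

lemma mon_degree_add: "mon_degree (m + m') = mon_degree m + mon_degree m'"
proof -
  define A where "A = Poly_Mapping.keys m \<union> Poly_Mapping.keys m'"
  have A: "finite A" "Poly_Mapping.keys (m + m') \<subseteq> A" "Poly_Mapping.keys m \<subseteq> A"
      "Poly_Mapping.keys m' \<subseteq> A"
    using Poly_Mapping.keys_add[of m m'] by (auto simp: A_def)
  show ?thesis
    by (simp add: mon_degree_superset[OF A(1,2)] mon_degree_superset[OF A(1,3)]
        mon_degree_superset[OF A(1,4)] lookup_add sum.distrib)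
qed

lemma eval_poly_superset:
  assumes "finite A" "Poly_Mapping.keys f \<subseteq> A"
  shows "eval_poly f a = (\<Sum>m\<in>A. Poly_Mapping.lookup f m * eval_monom m a)"
  unfolding eval_poly_def eval_monom_def[symmetric]
  by (rule sum.mono_neutral_left) (use assms in \<open>auto simp: in_keys_iff\<close>)

lemma eval_poly_zero [simp]: "eval_poly 0 a = 0"
  by (simp add: eval_poly_def)

lemma eval_poly_single [simp]: "eval_poly (Poly_Mapping.single m c) a = c * eval_monom m a"
  by (simp add: eval_poly_def eval_monom_def)

lemma eval_poly_add [simp]: "eval_poly (f + g) a = eval_poly f a + eval_poly g a"
proof -
  define A where "A = Poly_Mapping.keys f \<union> Poly_Mapping.keys g"
  have A: "finite A" "Poly_Mapping.keys (f + g) \<subseteq> A" "Poly_Mapping.keys f \<subseteq> A"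
      "Poly_Mapping.keys g \<subseteq> A"
    using Poly_Mapping.keys_add[of f g] by (auto simp: A_def)
  show ?thesis
    by (simp add: eval_poly_superset[OF A(1,2)] eval_poly_superset[OF A(1,3)]
        eval_poly_superset[OF A(1,4)] lookup_add algebra_simps sum.distrib)
qed

lemma eval_poly_sum: "eval_poly (sum h B) a = (\<Sum>b\<in>B. eval_poly (h b) a)"
  by (induction B rule: infinite_finite_induct) auto

lemma poly_sum_singles:
  "f = (\<Sum>m\<in>Poly_Mapping.keys f. Poly_Mapping.single m (Poly_Mapping.lookup f m))"
proof (rule poly_mapping_eqI)
  fix k
  show "Poly_Mapping.lookup f k = Poly_Mapping.lookup
      (\<Sum>m\<in>Poly_Mapping.keys f. Poly_Mapping.single m (Poly_Mapping.lookup f m)) k"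
    by (auto simp: lookup_sum lookup_single when_def in_keys_iff if_distrib cong: if_cong)
qed

lemma eval_poly_mult [simp]: "eval_poly (f * g) a = eval_poly f a * eval_poly g a"
proof -
  let ?s = "\<lambda>f m. Poly_Mapping.single m (Poly_Mapping.lookup f m)"
  have "f * g = (\<Sum>m\<in>Poly_Mapping.keys f. \<Sum>k\<in>Poly_Mapping.keys g. ?s f m * ?s g k)"
    by (subst poly_sum_singles[of f], subst poly_sum_singles[of g]) (simp add: sum_product)
  then have "eval_poly (f * g) a = (\<Sum>m\<in>Poly_Mapping.keys f. \<Sum>k\<in>Poly_Mapping.keys g.
      (Poly_Mapping.lookup f m * eval_monom m a) * (Poly_Mapping.lookup g k * eval_monom k a))"
    by (simp add: eval_poly_sum mult_single eval_monom_add algebra_simps)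
  also have "\<dots> = eval_poly f a * eval_poly g a"
    by (simp add: sum_product eval_poly_superset[OF finite_keys subset_refl])
  finally show ?thesis .
qed

lemma eval_poly_scale [simp]: "eval_poly (scale_poly c f) a = c * eval_poly f a"
  by (simp add: scale_poly_def eval_monom_def)

section \<open>Closure of the polynomial ring and of its graded pieces\<close>

lemma poly_ring_add: "f \<in> poly_ring n \<Longrightarrow> g \<in> poly_ring n \<Longrightarrow> f + g \<in> poly_ring n"
  using Poly_Mapping.keys_add[of f g] by (fastforce simp: poly_ring_def)

lemma poly_ring_mult:
  assumes "f \<in> poly_ring n" "g \<in> poly_ring n"
  shows "f * g \<in> poly_ring n"
  unfolding poly_ring_def
proof (intro CollectI ballI)
  fix m assume "m \<in> Poly_Mapping.keys (f * g)"
  then obtain a b where "m = a + b" "a \<in> Poly_Mapping.keys f" "b \<in> Poly_Mapping.keys g"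
    using Poly_Mapping.keys_mult[of f g] by blast
  then show "Poly_Mapping.keys m \<subseteq> {..n}"
    using assms Poly_Mapping.keys_add[of a b] by (fastforce simp: poly_ring_def)
qed

lemma forms_zero: "0 \<in> forms n d"
  by (simp add: forms_def poly_ring_def)

lemma forms_add: "f \<in> forms n d \<Longrightarrow> g \<in> forms n d \<Longrightarrow> f + g \<in> forms n d"
  using Poly_Mapping.keys_add[of f g] poly_ring_add[of f n g] by (fastforce simp: forms_def)

lemma forms_mult:
  assumes "f \<in> forms n d" "g \<in> forms n e"
  shows "f * g \<in> forms n (d + e)"
  unfolding forms_def
proof (intro CollectI conjI ballI)
  show "f * g \<in> poly_ring n"
    using assms by (auto simp: forms_def intro: poly_ring_mult)
  fix m assume "m \<in> Poly_Mapping.keys (f * g)"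
  then obtain a b where "m = a + b" "a \<in> Poly_Mapping.keys f" "b \<in> Poly_Mapping.keys g"
    using Poly_Mapping.keys_mult[of f g] by blast
  then show "mon_degree m = d + e"
    using assms by (auto simp: forms_def mon_degree_add)
qed

lemma forms_single_zero: "Poly_Mapping.single 0 c \<in> forms n 0"
  by (simp add: forms_def poly_ring_def mon_degree_def)

lemma forms_scale: "f \<in> forms n d \<Longrightarrow> scale_poly c f \<in> forms n d"
  using forms_mult[OF forms_single_zero[of c n], of f d] by (simp add: scale_poly_def)

lemma forms_sum: "(\<And>b. b \<in> B \<Longrightarrow> h b \<in> forms n d) \<Longrightarrow> sum h B \<in> forms n d"
  by (induction B rule: infinite_finite_induct) (auto intro: forms_zero forms_add)

lemma forms_var: "i \<le> n \<Longrightarrow> Poly_Mapping.single (Poly_Mapping.single i 1) 1 \<in> forms n 1"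
  by (simp add: forms_def poly_ring_def mon_degree_def)

lemma forms_mono: "n \<le> n' \<Longrightarrow> forms n d \<subseteq> forms n' d"
  by (fastforce simp: forms_def poly_ring_def)

lemma poly_ring_eval_cong:
  assumes "f \<in> poly_ring n" "\<And>i. i \<le> n \<Longrightarrow> a i = b i"
  shows "eval_poly f a = eval_poly f b"
  unfolding eval_poly_def
proof (intro sum.cong prod.cong arg_cong2[where f = "(*)"] refl)
  fix m i assume "m \<in> Poly_Mapping.keys f" "i \<in> Poly_Mapping.keys m"
  then have "i \<le> n" using assms(1) by (auto simp: poly_ring_def)
  then show "a i ^ Poly_Mapping.lookup m i = b i ^ Poly_Mapping.lookup m i"
    by (simp add: assms(2))
qed

text \<open>Indexing by all of \<open>{..n}\<close> instead of the support of each monomial later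
  lets a sum over a box factor into power sums, one for each variable.\<close>

lemma forms_eval_expand:
  assumes "f \<in> forms n d"
  obtains "eval_poly f = (\<lambda>a. \<Sum>m\<in>Poly_Mapping.keys f. Poly_Mapping.lookup f m *
      (\<Prod>i\<le>n. a i ^ Poly_Mapping.lookup m i))"
    and "\<And>m. m \<in> Poly_Mapping.keys f \<Longrightarrow> (\<Sum>i\<le>n. Poly_Mapping.lookup m i) = d"
proof
  have k: "Poly_Mapping.keys m \<subseteq> {..n}" "mon_degree m = d" if "m \<in> Poly_Mapping.keys f" for m
    using assms that by (auto simp: forms_def poly_ring_def)
  show "eval_poly f = (\<lambda>a. \<Sum>m\<in>Poly_Mapping.keys f. Poly_Mapping.lookup f m *
      (\<Prod>i\<le>n. a i ^ Poly_Mapping.lookup m i))"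
    by (simp add: fun_eq_iff eval_poly_superset[OF finite_keys subset_refl]
        eval_monom_superset[OF finite_atMost k(1)])
  show "(\<Sum>i\<le>n. Poly_Mapping.lookup m i) = d" if "m \<in> Poly_Mapping.keys f" for m
    using k[OF that] mon_degree_superset[OF finite_atMost k(1)[OF that]] by simp
qed

lemma forms_eval_scale:
  assumes "f \<in> forms n d"
  shows "eval_poly f (\<lambda>i. c * a i) = c ^ d * eval_poly f a"
proof -
  have "eval_monom m (\<lambda>i. c * a i) = c ^ mon_degree m * eval_monom m a" for m
    by (simp add: eval_monom_def mon_degree_def power_mult_distrib prod.distrib power_sum)
  then show ?thesis
    using assms by (simp add: eval_poly_superset[OF finite_keys subset_refl] sum_distrib_left
        forms_def algebra_simps)
qed

section \<open>Polynomial functions defined by forms\<close>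

text \<open>Only values of forms matter below, and functions can be written as lambda terms. Over a
  finite field distinct forms may define the same function, so a function need not determine
  \<open>d\<close>.\<close>

definition form_funs :: "nat \<Rightarrow> nat \<Rightarrow> ((nat \<Rightarrow> 'a::field) \<Rightarrow> 'a) set" where
  "form_funs n d = eval_poly ` forms n d"

lemma form_funs_add:
  "f \<in> form_funs n d \<Longrightarrow> g \<in> form_funs n d \<Longrightarrow> (\<lambda>a. f a + g a) \<in> form_funs n d"
  unfolding form_funs_def by (force intro!: image_eqI[OF _ forms_add])

lemma form_funs_mult:
  "f \<in> form_funs n d \<Longrightarrow> g \<in> form_funs n e \<Longrightarrow> (\<lambda>a. f a * g a) \<in> form_funs n (d + e)"
  unfolding form_funs_def by (force intro!: image_eqI[OF _ forms_mult])

lemma form_funs_scale: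
  "f \<in> form_funs n d \<Longrightarrow> (\<lambda>a. c * f a) \<in> form_funs n d"
  unfolding form_funs_def by (force intro!: image_eqI[OF _ forms_scale])

lemma form_funs_diff:
  "f \<in> form_funs n d \<Longrightarrow> g \<in> form_funs n d \<Longrightarrow> (\<lambda>a. f a - g a) \<in> form_funs n d"
  using form_funs_add[of f n d "\<lambda>a. (-1) * g a"] form_funs_scale[of g n d "-1"] by simp

lemma form_funs_zero: "(\<lambda>a. 0) \<in> form_funs n d"
  unfolding form_funs_def by (force intro!: image_eqI[OF _ forms_zero])

lemma form_funs_sum:
  "(\<And>b. b \<in> B \<Longrightarrow> h b \<in> form_funs n d) \<Longrightarrow> (\<lambda>a. \<Sum>b\<in>B. h b a) \<in> form_funs n d"
  by (induction B rule: infinite_finite_induct) (auto intro: form_funs_zero form_funs_add)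

lemma form_funs_one: "(\<lambda>a. 1) \<in> form_funs n 0"
  unfolding form_funs_def
  by (rule image_eqI[OF _ forms_single_zero[of 1]]) (simp add: eval_monom_def fun_eq_iff del: single_one)

lemma form_funs_var: "i \<le> n \<Longrightarrow> (\<lambda>a. a i) \<in> form_funs n 1"
  unfolding form_funs_def
  by (rule image_eqI[OF _ forms_var]) (simp_all add: eval_monom_def fun_eq_iff)

lemma form_funs_prod:
  assumes "finite B" "\<And>b. b \<in> B \<Longrightarrow> h b \<in> form_funs n 1"
  shows "(\<lambda>a. \<Prod>b\<in>B. h b a) \<in> form_funs n (card B)"
  using assms
proof (induction B rule: finite_induct)
  case empty
  then show ?case by (simp add: form_funs_one)
next
  case (insert b B)
  then show ?case using form_funs_mult[of "h b" n 1] by simp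
qed

lemma form_funs_var_power: "i \<le> n \<Longrightarrow> (\<lambda>a. a i ^ e) \<in> form_funs n e"
  using form_funs_prod[of "{..<e}" "\<lambda>_ a. a i" n] form_funs_var[of i n] by simp

lemma form_funs_mono: "n \<le> n' \<Longrightarrow> f \<in> form_funs n d \<Longrightarrow> f \<in> form_funs n' d"
  using forms_mono[of n n' d] by (auto simp: form_funs_def)

lemma form_funs_cong:
  "f \<in> form_funs n d \<Longrightarrow> (\<And>i. i \<le> n \<Longrightarrow> a i = b i) \<Longrightarrow> f a = f b"
  using poly_ring_eval_cong[of _ n a b] by (auto simp: form_funs_def forms_def)

lemma form_funs_homogeneous: "f \<in> form_funs n d \<Longrightarrow> f (\<lambda>i. c * a i) = c ^ d * f a"
  by (auto simp: form_funs_def forms_eval_scale)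

text \<open>Homogeneity with factor \<open>0\<close>; positivity of \<open>d\<close> excludes
  \<open>0 ^ 0 = 1\<close>. This disposes of the zero vector in sums over a box, and of the last
  coordinate point when \<open>f\<close> does not involve the last variable.\<close>

lemma form_funs_at_zero:
  assumes "f \<in> form_funs n d" "d > 0" "\<And>i. i \<le> n \<Longrightarrow> a i = 0"
  shows "f a = 0"
proof -
  have "f a = f (\<lambda>i. 0 * a i)"
    by (rule form_funs_cong[OF assms(1)]) (simp add: assms(3))
  also have "\<dots> = 0 ^ d * f a"
    by (rule form_funs_homogeneous[OF assms(1)])
  also have "\<dots> = 0"
    using assms(2) by (simp add: power_0_left)
  finally show ?thesis .
qed

section \<open>Normalised representatives\<close>

definition box :: "nat \<Rightarrow> (nat \<Rightarrow> 'a::field set) \<Rightarrow> (nat \<Rightarrow> 'a) set" where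
  "box n K = {a. (\<forall>i\<le>n. a i \<in> K i) \<and> (\<forall>i>n. a i = 0)}"

definition normal_vecs :: "nat \<Rightarrow> (nat \<Rightarrow> 'a::field set) \<Rightarrow> (nat \<Rightarrow> 'a) set" where
  "normal_vecs n K = {a \<in> box n K. \<exists>k\<le>n. (\<forall>i<k. a i = 0) \<and> a k = 1}"

lemma finite_box: "finite (box n (K :: nat \<Rightarrow> 'a::{field,finite} set))"
proof (rule finite_subset)
  show "box n K \<subseteq> {a. \<forall>i. (i \<in> {..n} \<longrightarrow> a i \<in> UNIV) \<and> (i \<notin> {..n} \<longrightarrow> a i = 0)}"
    by (auto simp: box_def)
  show "finite {a :: nat \<Rightarrow> 'a. \<forall>i. (i \<in> {..n} \<longrightarrow> a i \<in> UNIV) \<and> (i \<notin> {..n} \<longrightarrow> a i = 0)}"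
    by (rule finite_set_of_finite_funs) auto
qed

lemma finite_normal_vecs: "finite (normal_vecs n (K :: nat \<Rightarrow> 'a::{field,finite} set))"
  using finite_box[of n K] by (auto simp: normal_vecs_def)

text \<open>\<open>box\<close> pads vectors with \<open>0\<close> and \<open>PiE\<close> with
  \<open>undefined\<close>, a difference invisible to a form in the variables up to
  \<open>n\<close>. The distributive law for products of sums is applied over
  \<open>PiE\<close>.\<close>

lemma sum_box_eq_PiE:
  assumes "f \<in> form_funs n d"
  shows "(\<Sum>x\<in>box n K. f x) = (\<Sum>x\<in>PiE {..n} K. f x)"
  by (rule sum.reindex_bij_witness[of _ "\<lambda>x i. if i \<le> n then x i else 0" "\<lambda>x. restrict x {..n}"])
     (auto simp: box_def PiE_def extensional_def fun_eq_iff intro: form_funs_cong[OF assms])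

locale subfield_tower =
  fixes n :: nat and K :: "nat \<Rightarrow> 'a::{field,finite} set"
  assumes subfield: "i \<le> n \<Longrightarrow> is_subfield (K i)"
    and chain: "i < n \<Longrightarrow> K i \<subseteq> K (Suc i)"
begin

lemma tower_mono:
  assumes "i \<le> j" "j \<le> n"
  shows "K i \<subseteq> K j"
  using assms
proof (induction j rule: dec_induct)
  case (step j)
  then show ?case using chain[of j] by auto
qed simp

text \<open>The tower enters here: the first nonzero coordinate lies in \<open>K k\<close>, hence in
  every later field, so dividing by it stays inside the box.\<close>

lemma box_normalise:
  assumes x: "x \<in> box n K" and nz: "\<exists>i\<le>n. x i \<noteq> 0"
  obtains c Q where "c \<noteq> 0" "Q \<in> normal_vecs n K" "x = (\<lambda>i. c * Q i)"
proof -
  define k where "k = (LEAST i. x i \<noteq> 0)"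
  have k: "x k \<noteq> 0" "k \<le> n" "\<And>i. i < k \<Longrightarrow> x i = 0"
    using nz LeastI_ex[of "\<lambda>i. x i \<noteq> 0"] Least_le[of "\<lambda>i. x i \<noteq> 0"] not_less_Least[of _ "\<lambda>i. x i \<noteq> 0"]
    unfolding k_def by (blast, meson le_trans, blast)
  have "x i / x k \<in> K i" if "i \<le> n" for i
  proof (cases "i < k")
    case True
    then show ?thesis using k(3) subfield_zero[OF subfield[OF that]] by simp
  next
    case False
    then have "x k \<in> K i"
      using tower_mono[of k i] that x k(2) by (auto simp: box_def)
    then show ?thesis
      using x that by (intro subfield_divide subfield) (auto simp: box_def)
  qed
  then have "(\<lambda>i. x i / x k) \<in> normal_vecs n K"
    using x k by (auto simp: normal_vecs_def box_def intro!: exI[of _ k])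
  then show ?thesis
    using k(1) by (intro that[of "x k" "\<lambda>i. x i / x k"]) auto
qed

text \<open>A scalar from \<open>K k\<close> lies in every later field, and the coordinates before
  \<open>k\<close> are zero.\<close>

lemma normal_vec_scale_in_box:
  assumes "P \<in> normal_vecs n K" "\<And>i. i < k \<Longrightarrow> P i = 0" "c \<in> K k"
  shows "(\<lambda>i. c * P i) \<in> box n K"
proof -
  have "c * P i \<in> K i" if "i \<le> n" for i
  proof (cases "i < k")
    case True
    then show ?thesis using assms(2) subfield_zero[OF subfield[OF that]] by simp
  next
    case False
    then have "c \<in> K i" using tower_mono[of k i] that assms(3) by auto
    then show ?thesis
      using assms(1) that by (intro subfield_mult subfield) (auto simp: normal_vecs_def box_def)
  qed
  then show ?thesis using assms(1) by (auto simp: normal_vecs_def box_def)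
qed

end

section \<open>Interpolation in large degree\<close>

text \<open>The index starts at \<open>1\<close>: for finite nonempty sets this is the largest
  degree of a monomial in \<open>t_1, ..., t_n\<close> in which each \<open>t_i\<close> has exponent
  below \<open>card (K i)\<close>. The regularity will be one more.\<close>

definition socle_degree :: "nat \<Rightarrow> (nat \<Rightarrow> 'a set) \<Rightarrow> nat" where
  "socle_degree n K = (\<Sum>i=1..n. card (K i) - 1)"

lemma socle_degree_Suc: "socle_degree (Suc n) K = socle_degree n K + (card (K (Suc n)) - 1)"
  by (simp add: socle_degree_def)

text \<open>Lagrange interpolation: the indicators are combined with the prescribed values as
  coefficients.\<close>

lemma interpolation_from_indicators:
  fixes N :: "(nat \<Rightarrow> 'a::field) set"
  assumes "finite N"
    and "\<And>P. P \<in> N \<Longrightarrow> \<exists>f\<in>form_funs n d. \<forall>Q\<in>N. f Q = (if Q = P then 1 else 0)"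
  shows "\<exists>h\<in>form_funs n d. \<forall>Q\<in>N. h Q = g Q"
proof -
  obtain F where F: "\<And>P. P \<in> N \<Longrightarrow> F P \<in> form_funs n d"
      "\<And>P Q. P \<in> N \<Longrightarrow> Q \<in> N \<Longrightarrow> F P Q = (if Q = P then 1 else 0)"
    using assms(2) by metis
  have "(\<lambda>a. \<Sum>P\<in>N. g P * F P a) \<in> form_funs n d"
    by (intro form_funs_sum form_funs_scale F)
  moreover have "(\<Sum>P\<in>N. g P * F P Q) = g Q" if "Q \<in> N" for Q
    using that assms(1) by (simp add: F(2) if_distrib cong: if_cong)
  ultimately show ?thesis by (intro bexI[of _ "\<lambda>a. \<Sum>P\<in>N. g P * F P a"]) auto
qed

section \<open>Projection from the last coordinate point and induction on the dimension\<close>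

text \<open>A vector other than the last unit vector has its leading \<open>1\<close> at an earlier
  index, so the leading \<open>1\<close> survives when the last coordinate is set to zero.\<close>

lemma normal_vecs_Suc_cases:
  assumes "Q \<in> normal_vecs (Suc n) K"
  obtains "Q = (\<lambda>i. if i = Suc n then 1 else 0)"
  | "Q(Suc n := 0) \<in> normal_vecs n K"
proof -
  obtain k where k: "k \<le> Suc n" "\<And>i. i < k \<Longrightarrow> Q i = 0" "Q k = 1" and Q: "Q \<in> box (Suc n) K"
    using assms by (auto simp: normal_vecs_def)
  show ?thesis
  proof (cases "k = Suc n")
    case True
    have "Q i = (if i = Suc n then 1 else 0)" for i
      using k Q True by (cases i "Suc n" rule: linorder_cases) (auto simp: box_def)
    then show ?thesis by (intro that) auto
  next
    case False
    then have "Q(Suc n := 0) \<in> normal_vecs n K"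
      using k Q by (auto simp: box_def normal_vecs_def intro!: exI[of _ k])
    then show ?thesis by (rule that)
  qed
qed

text \<open>If \<open>h\<close> is a form of degree \<open>D\<close> equal to \<open>1\<close> on the smaller set, the separator
  \<open>t_{n+1} (t_{n+1}^D - h)\<close> works because \<open>D\<close> is a multiple of the order of the group of units
  of the largest field.\<close>

lemma last_point_separator:
  assumes "subfield_tower (Suc n) K"
    and D: "D = m * (card (K (Suc n)) - 1)" "D > 0"
    and h: "h \<in> form_funs n D" "\<And>Q. Q \<in> normal_vecs n K \<Longrightarrow> h Q = 1"
  shows "\<exists>f\<in>form_funs (Suc n) (Suc D). \<forall>Q\<in>normal_vecs (Suc n) K.
      f Q = (if Q = (\<lambda>i. if i = Suc n then 1 else 0) then 1 else 0)"
proof (rule bexI[of _ "\<lambda>a. a (Suc n) * (a (Suc n) ^ D - h a)"], intro ballI)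
  interpret subfield_tower "Suc n" K by fact
  show "(\<lambda>a. a (Suc n) * (a (Suc n) ^ D - h a)) \<in> form_funs (Suc n) (Suc D)"
    using form_funs_mult[OF form_funs_var form_funs_diff[OF form_funs_var_power
        form_funs_mono[OF _ h(1)]], of "Suc n" "Suc n" "Suc n"] by simp
  fix Q assume Q: "Q \<in> normal_vecs (Suc n) K"
  then show "Q (Suc n) * (Q (Suc n) ^ D - h Q)
      = (if Q = (\<lambda>i. if i = Suc n then 1 else 0) then 1 else 0)"
  proof (cases rule: normal_vecs_Suc_cases)
    case 1
    have "h Q = 0"
      by (rule form_funs_at_zero[OF h(1) D(2)]) (simp add: 1)
    then show ?thesis using 1 by simp
  next
    case 2
    have "h Q = h (Q(Suc n := 0))"
      by (rule form_funs_cong[OF h(1)]) simp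
    then have hQ: "h Q = 1" using h(2)[OF 2] by simp
    have "Q (Suc n) ^ D = 1" if "Q (Suc n) \<noteq> 0"
    proof -
      have "Q (Suc n) ^ (card (K (Suc n)) - 1) = 1"
        using Q that by (intro subfield_power_card subfield) (auto simp: normal_vecs_def box_def)
      then show ?thesis
        unfolding D(1) mult.commute[of m] power_mult by simp
    qed
    moreover have "Q \<noteq> (\<lambda>i. if i = Suc n then 1 else 0)"
      using 2 by (auto simp: normal_vecs_def)
    ultimately show ?thesis using hQ by auto
  qed
qed

lemma subfield_tower_pred: "subfield_tower (Suc n) K \<Longrightarrow> subfield_tower n K"
  by (auto simp: subfield_tower_def)

text \<open>The last coordinate point is handled by \<open>last_point_separator\<close>. For any
  other \<open>P\<close>, an indicator of its projection in degree \<open>d - q\<close> is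
  multiplied by \<open>q\<close> linear forms that remove the other points of the same
  fibre.\<close>

lemma indicator_form:
  assumes "subfield_tower n K" "d > socle_degree n K" "P \<in> normal_vecs n K"
  shows "\<exists>f\<in>form_funs n d. \<forall>Q\<in>normal_vecs n K. f Q = (if Q = P then 1 else 0)"
  using assms
proof (induction n arbitrary: d P)
  case 0
  have *: "Q 0 = 1" "Q = P" if "Q \<in> normal_vecs 0 K" for Q
    using that 0(3) by (auto simp: normal_vecs_def box_def fun_eq_iff) (metis gr0I)
  show ?case
    by (rule bexI[OF _ form_funs_var_power[of 0]]) (auto simp: *)
next
  case (Suc n)
  interpret subfield_tower "Suc n" K by fact
  define q where "q = card (K (Suc n)) - 1"
  have q: "q > 0"
    using subfield_card_ge_2[OF subfield[of "Suc n"]] by (simp add: q_def)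
  have d: "d > socle_degree n K + q"
    using Suc.prems(2) by (simp add: socle_degree_Suc q_def)
  note IH = Suc.IH[OF subfield_tower_pred[OF Suc.prems(1)]]
  from Suc.prems(3) show ?case
  proof (cases rule: normal_vecs_Suc_cases)
    case 1
    \<comment> \<open>The least multiple of \<open>q\<close> above the smaller socle degree. It
      exceeds that degree by at most \<open>q\<close>, so the separator of degree
      \<open>Suc D\<close> still fits into degree \<open>d\<close>.\<close>
    define D where "D = (socle_degree n K div q + 1) * q"
    have D: "D > socle_degree n K" "D \<le> socle_degree n K + q"
      using q dividend_less_div_times[OF q, of "socle_degree n K"]
      by (auto simp: D_def algebra_simps)
    obtain h where h: "h \<in> form_funs n D" "\<And>Q. Q \<in> normal_vecs n K \<Longrightarrow> h Q = 1"
      using interpolation_from_indicators[OF finite_normal_vecs IH[OF D(1)], of "\<lambda>_. 1"] by blast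
    obtain f where f: "f \<in> form_funs (Suc n) (Suc D)"
        "\<And>Q. Q \<in> normal_vecs (Suc n) K \<Longrightarrow> f Q = (if Q = P then 1 else 0)"
      using last_point_separator[OF Suc.prems(1) D_def[unfolded q_def] _ h] D(1) 1 by auto
    \<comment> \<open>The last variable is \<open>1\<close> at \<open>P\<close>, so its powers raise
      the degree without changing the indicator.\<close>
    have "(\<lambda>a. f a * a (Suc n) ^ (d - Suc D)) \<in> form_funs (Suc n) d"
      using form_funs_mult[OF f(1) form_funs_var_power[of "Suc n" "Suc n" "d - Suc D"]] d D(2) by simp
    then show ?thesis
      by (rule bexI[rotated]) (use f(2) 1 in auto)
  next
    case 2
    then obtain k where k: "k \<le> n" "P k = 1"
      by (auto simp: normal_vecs_def)
    define B where "B = K (Suc n) - {P (Suc n)}"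
    have PK: "P (Suc n) \<in> K (Suc n)"
      using Suc.prems(3) by (simp add: normal_vecs_def box_def)
    have cardB: "card B = q"
      using PK by (simp add: B_def q_def)
    obtain f where f: "f \<in> form_funs n (d - q)"
        "\<And>Q. Q \<in> normal_vecs n K \<Longrightarrow> f Q = (if Q = P(Suc n := 0) then 1 else 0)"
      using IH[OF _ 2, of "d - q"] d by (metis less_diff_conv)
    have fQ: "f Q = f (Q(Suc n := 0))" for Q
      by (rule form_funs_cong[OF f(1)]) simp
    \<comment> \<open>On the fibre the coordinate \<open>k\<close> equals \<open>1\<close>, so the
      factor for \<open>b\<close> vanishes exactly where the last coordinate is \<open>b\<close>;
      the variable \<open>k\<close> serves to homogenise.\<close>
    define g where "g = (\<lambda>a. \<Prod>b\<in>B. a (Suc n) - b * a k)"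
    have "g \<in> form_funs (Suc n) q"
      unfolding g_def cardB[symmetric]
      by (intro form_funs_prod form_funs_diff form_funs_scale form_funs_var) (use k in auto)
    from form_funs_mult[OF form_funs_mono[OF _ f(1)] this]
    have fg: "(\<lambda>a. inverse (g P) * (f a * g a)) \<in> form_funs (Suc n) d"
      using d by (intro form_funs_scale) simp
    have gP: "g P \<noteq> 0"
      by (auto simp: g_def B_def k)
    show ?thesis
    proof (rule bexI[OF ballI fg])
      fix Q assume Q: "Q \<in> normal_vecs (Suc n) K"
      then show "inverse (g P) * (f Q * g Q) = (if Q = P then 1 else 0)"
      proof (cases rule: normal_vecs_Suc_cases)
        assume Qe: "Q = (\<lambda>i. if i = Suc n then 1 else 0)"
        have "f Q = 0"
          by (rule form_funs_at_zero[OF f(1)]) (use d Qe in auto)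
        moreover have "Q \<noteq> P" using Qe k by auto
        ultimately show ?thesis by simp
      next
        assume Q': "Q(Suc n := 0) \<in> normal_vecs n K"
        show ?thesis
        proof (cases "Q(Suc n := 0) = P(Suc n := 0)")
          case False
          then show ?thesis using f(2)[OF Q'] fQ[of Q] by auto
        next
          case eq: True
          then have "f Q = 1" using f(2)[OF Q'] fQ[of Q] by auto
          moreover have "Q k = 1"
            using fun_cong[OF eq, of k] k by simp
          moreover have "Q = P \<longleftrightarrow> Q (Suc n) = P (Suc n)"
            using eq by (metis fun_upd_triv fun_upd_upd)
          moreover have "Q (Suc n) \<in> K (Suc n)"
            using Q by (simp add: normal_vecs_def box_def)
          then have "Q (Suc n) \<noteq> P (Suc n) \<Longrightarrow> Q (Suc n) \<in> B"
            by (simp add: B_def)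
          ultimately show ?thesis
            using gP by (auto simp: g_def)
        qed
      qed
    qed
  qed
qed

lemma interpolation:
  assumes "subfield_tower n K" "d > socle_degree n K"
  shows "\<exists>h\<in>form_funs n d. \<forall>Q\<in>normal_vecs n K. h Q = g Q"
  using interpolation_from_indicators[OF finite_normal_vecs indicator_form[OF assms]] .

section \<open>Linear relations between values of forms\<close>

text \<open>The sum is distributed over the product in each monomial. One \<open>p\<close> serves
  every \<open>L\<close>, so sums over different boxes can be compared monomial by monomial.\<close>

lemma form_fun_box_sum_expand:
  assumes "f \<in> form_funs n d"
  obtains p where "\<And>L :: nat \<Rightarrow> 'a::{field,finite} set. (\<Sum>x\<in>box n L. f x) =
      (\<Sum>m\<in>Poly_Mapping.keys p. Poly_Mapping.lookup p m *
        (\<Prod>i\<le>n. \<Sum>y\<in>L i. y ^ Poly_Mapping.lookup m i))"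
    and "\<And>m. m \<in> Poly_Mapping.keys p \<Longrightarrow> (\<Sum>i\<le>n. Poly_Mapping.lookup m i) = d"
proof -
  obtain p where p: "p \<in> forms n d" "f = eval_poly p"
    using assms by (auto simp: form_funs_def)
  show ?thesis
  proof (rule forms_eval_expand[OF p(1)])
    assume *: "eval_poly p = (\<lambda>a. \<Sum>m\<in>Poly_Mapping.keys p. Poly_Mapping.lookup p m *
        (\<Prod>i\<le>n. a i ^ Poly_Mapping.lookup m i))"
      and "\<And>m. m \<in> Poly_Mapping.keys p \<Longrightarrow> (\<Sum>i\<le>n. Poly_Mapping.lookup m i) = d"
    show ?thesis
    proof (rule that[of p])
      fix L :: "nat \<Rightarrow> 'a set"
      have "(\<Sum>x\<in>box n L. f x) = (\<Sum>x\<in>PiE {..n} L. f x)"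
        by (rule sum_box_eq_PiE[OF assms])
      also have "\<dots> = (\<Sum>m\<in>Poly_Mapping.keys p. Poly_Mapping.lookup p m *
          (\<Sum>x\<in>PiE {..n} L. \<Prod>i\<le>n. x i ^ Poly_Mapping.lookup m i))"
        unfolding p(2) * by (subst sum.swap) (simp add: sum_distrib_left)
      finally show "(\<Sum>x\<in>box n L. f x) = (\<Sum>m\<in>Poly_Mapping.keys p. Poly_Mapping.lookup p m *
        (\<Prod>i\<le>n. \<Sum>y\<in>L i. y ^ Poly_Mapping.lookup m i))"
        by (simp add: prod_sum_PiE)
    qed fact
  qed
qed

context subfield_tower
begin

lemma socle_degree_pos:
  assumes "n \<ge> 1"
  shows "socle_degree n K > 0"
proof -
  have "card (K 1) - 1 \<le> socle_degree n K"
    unfolding socle_degree_def by (rule member_le_sum) (use assms in auto)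
  then show ?thesis
    using subfield_card_ge_2[OF subfield[OF assms]] by linarith
qed

text \<open>The Chevalley--Warning argument: by the degree bound each monomial has an exponent below
  \<open>card (K i) - 1\<close> for some \<open>i\<close>, and the power sum at that
  \<open>i\<close> vanishes.\<close>

lemma box_sum_small_degree:
  assumes f: "f \<in> form_funs n d" and d: "d < (\<Sum>i\<le>n. card (K i) - 1)"
  shows "(\<Sum>x\<in>box n K. f x) = 0"
proof (rule form_fun_box_sum_expand[OF f])
  fix p
  assume p: "\<And>L :: nat \<Rightarrow> 'a set. (\<Sum>x\<in>box n L. f x) =
      (\<Sum>m\<in>Poly_Mapping.keys p. Poly_Mapping.lookup p m *
        (\<Prod>i\<le>n. \<Sum>y\<in>L i. y ^ Poly_Mapping.lookup m i))"
    and m: "\<And>m. m \<in> Poly_Mapping.keys p \<Longrightarrow> (\<Sum>i\<le>n. Poly_Mapping.lookup m i) = d"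
  have "(\<Prod>i\<le>n. \<Sum>y\<in>K i. y ^ Poly_Mapping.lookup m i) = 0" if "m \<in> Poly_Mapping.keys p" for m
  proof -
    obtain i where "i \<le> n" "Poly_Mapping.lookup m i < card (K i) - 1"
      using d m[OF \<open>m \<in> _\<close>] by (metis atMost_iff linorder_not_less sum_mono[of "{..n}"])
    then show ?thesis
      using subfield_power_sum[OF subfield, of i] by (intro prod_zero bexI[of _ i]) auto
  qed
  then show ?thesis
    unfolding p by (intro sum.neutral ballI) (simp only: mult_zero_right)
qed

text \<open>In degree \<open>socle_degree n K\<close> the box sum vanishes, yet it reduces to the
  nonzero multiples of \<open>P\<close>. The divisibility assumption makes all of them contribute
  equally, and their number is \<open>-1\<close> in the field.\<close>

lemma no_separator_below_socle_degree:
  assumes "n \<ge> 1" and m: "socle_degree n K = m * (card (K n) - 1)"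
    and f: "f \<in> form_funs n d" "d \<le> socle_degree n K"
    and P: "P \<in> normal_vecs n K" and van: "\<And>Q. Q \<in> normal_vecs n K \<Longrightarrow> Q \<noteq> P \<Longrightarrow> f Q = 0"
  shows "f P = 0"
proof -
  let ?S = "socle_degree n K"
  obtain k where k: "k \<le> n" "P k = 1" "\<And>i. i < k \<Longrightarrow> P i = 0"
    using P by (auto simp: normal_vecs_def)
  \<comment> \<open>The degree is raised to the socle degree; since \<open>P k = 1\<close>, the
    value at \<open>P\<close> is unchanged.\<close>
  define g where "g = (\<lambda>a. f a * a k ^ (?S - d))"
  have g: "g \<in> form_funs n ?S"
    using form_funs_mult[OF f(1) form_funs_var_power[OF k(1)], of "?S - d"] f(2)
    by (simp add: g_def)
  have S_pos: "?S > 0"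
    by (rule socle_degree_pos) fact
  have "card (K 0) \<ge> 2"
    by (auto intro!: subfield_card_ge_2 subfield)
  moreover have "(\<Sum>i\<le>n. card (K i) - 1) = card (K 0) - 1 + ?S"
    unfolding socle_degree_def atMost_atLeast0
    by (simp add: sum.atLeast_Suc_atMost)
  \<comment> \<open>The index \<open>0\<close> adds at least \<open>1\<close> to the sum, which
    makes the inequality strict.\<close>
  ultimately have S: "?S < (\<Sum>i\<le>n. card (K i) - 1)"
    by linarith
  \<comment> \<open>Any other element of the box is the zero vector or a multiple of a normalised
    vector different from \<open>P\<close>, and \<open>g\<close> vanishes there.\<close>
  have "(\<Sum>x\<in>box n K. g x) = (\<Sum>x\<in>(\<lambda>c i. c * P i) ` (K k - {0}). g x)"
  proof (rule sum.mono_neutral_right[OF finite_box])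
    show "(\<lambda>c i. c * P i) ` (K k - {0}) \<subseteq> box n K"
      using normal_vec_scale_in_box[OF P k(3)] by auto
    show "\<forall>x\<in>box n K - (\<lambda>c i. c * P i) ` (K k - {0}). g x = 0"
    proof
      fix x assume x: "x \<in> box n K - (\<lambda>c i. c * P i) ` (K k - {0})"
      show "g x = 0"
      proof (cases "\<exists>i\<le>n. x i \<noteq> 0")
        case False
        then show ?thesis by (intro form_funs_at_zero[OF g S_pos]) blast
      next
        case True
        then obtain c Q where cQ: "c \<noteq> 0" "Q \<in> normal_vecs n K" "x = (\<lambda>i. c * Q i)"
          using x by (auto elim: box_normalise)
        have "Q \<noteq> P"
        proof
          assume "Q = P"
          then have "c = x k" using cQ k by simp
          then have "c \<in> K k - {0}" using cQ(1) x k(1) by (auto simp: box_def)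
          then show False using x cQ \<open>Q = P\<close> by blast
        qed
        then have "g Q = 0" using van[OF cQ(2)] by (simp add: g_def)
        then show ?thesis using form_funs_homogeneous[OF g, of c Q] cQ(3) by simp
      qed
    qed
  qed
  also have "\<dots> = (\<Sum>c\<in>K k - {0}. g (\<lambda>i. c * P i))"
    by (rule sum.reindex_cong[of "\<lambda>c i. c * P i"])
       (use k(2) in \<open>auto simp: inj_on_def dest!: fun_cong[of _ _ k]\<close>)
  also have "\<dots> = (\<Sum>c\<in>K k - {0}. g P)"
  proof (rule sum.cong[OF refl])
    fix c assume "c \<in> K k - {0}"
    \<comment> \<open>Each \<open>c\<close> is a unit of \<open>K k\<close>, hence of the largest
      field \<open>K n\<close>.\<close>
    then have "c ^ (card (K n) - 1) = 1"
      using tower_mono[OF k(1) order_refl] by (intro subfield_power_card subfield) auto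
    then have "c ^ ?S = 1" by (simp add: m power_mult mult.commute[of m])
    then show "g (\<lambda>i. c * P i) = g P" using form_funs_homogeneous[OF g] by simp
  qed
  also have "\<dots> = of_nat (card (K k) - 1) * g P"
    using subfield_zero[OF subfield[OF k(1)]] by (simp add: card_Diff_singleton)
  also have "of_nat (card (K k) - 1) = (-1 :: 'a)"
    using subfield_of_nat_card[OF subfield[OF k(1)]] subfield_card_ge_2[OF subfield[OF k(1)]]
    by (simp add: of_nat_diff)
  finally show ?thesis
    using box_sum_small_degree[OF g S] k(2) by (simp add: g_def)
qed

section \<open>The obstruction in the socle degree at the first coordinate point\<close>

text \<open>Monomials free of \<open>t_0\<close> have equal sums over both slices, as
  \<open>0 ^ 0 = 1\<close>. If \<open>t_0\<close> occurs, the other exponents add up to less than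
  the socle degree, so some power sum vanishes and both slices give zero.\<close>

lemma box_sum_slices:
  assumes f: "f \<in> form_funs n (socle_degree n K)"
  shows "(\<Sum>x\<in>box n (K(0 := {1})). f x) = (\<Sum>x\<in>box n (K(0 := {0})). f x)"
proof (rule form_fun_box_sum_expand[OF f])
  fix p
  assume p: "\<And>L :: nat \<Rightarrow> 'a set. (\<Sum>x\<in>box n L. f x) =
      (\<Sum>m\<in>Poly_Mapping.keys p. Poly_Mapping.lookup p m *
        (\<Prod>i\<le>n. \<Sum>y\<in>L i. y ^ Poly_Mapping.lookup m i))"
    and deg: "\<And>m. m \<in> Poly_Mapping.keys p \<Longrightarrow>
      (\<Sum>i\<le>n. Poly_Mapping.lookup m i) = socle_degree n K"
  have split: "(\<Prod>i\<le>n. \<Sum>y\<in>(K(0 := {c})) i. y ^ e i) = c ^ e 0 * (\<Prod>i=1..n. \<Sum>y\<in>K i. y ^ e i)"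
    for c :: 'a and e :: "nat \<Rightarrow> nat"
    unfolding atMost_atLeast0 by (simp add: prod.atLeast_Suc_atMost)
  show ?thesis
    unfolding p split
  proof (intro sum.cong refl)
    fix m assume "m \<in> Poly_Mapping.keys p"
    note deg = deg[OF this]
    show "Poly_Mapping.lookup p m * (1 ^ Poly_Mapping.lookup m 0 *
        (\<Prod>i=1..n. \<Sum>y\<in>K i. y ^ Poly_Mapping.lookup m i)) =
      Poly_Mapping.lookup p m * (0 ^ Poly_Mapping.lookup m 0 *
        (\<Prod>i=1..n. \<Sum>y\<in>K i. y ^ Poly_Mapping.lookup m i))"
    proof (cases "Poly_Mapping.lookup m 0 = 0")
      case False
      have "(\<Sum>i=1..n. Poly_Mapping.lookup m i) < (\<Sum>i=1..n. card (K i) - 1)"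
        using deg False unfolding socle_degree_def atMost_atLeast0
        by (simp add: sum.atLeast_Suc_atMost)
      then obtain i where "i \<in> {1..n}" "Poly_Mapping.lookup m i < card (K i) - 1"
        by (meson linorder_not_less sum_mono)
      then have "(\<Prod>i=1..n. \<Sum>y\<in>K i. y ^ Poly_Mapping.lookup m i) = 0"
        using subfield_power_sum[OF subfield, of i] by (intro prod_zero bexI[of _ i]) auto
      then show ?thesis by (simp only: mult_zero_right)
    qed simp
  qed
qed

text \<open>The slice with first coordinate \<open>1\<close> consists of normalised vectors, so its
  sum is the value at the first point. The slice with first coordinate \<open>0\<close> holds only
  the zero vector and multiples of other normalised vectors, so its sum is zero.\<close>

lemma no_first_point_separator:
  assumes "n \<ge> 1" and f: "f \<in> form_funs n (socle_degree n K)"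
    and van: "\<And>Q. Q \<in> normal_vecs n K \<Longrightarrow> Q \<noteq> (\<lambda>i. if i = 0 then 1 else 0) \<Longrightarrow> f Q = 0"
  shows "f (\<lambda>i. if i = 0 then 1 else 0) = 0"
proof -
  let ?e = "\<lambda>i::nat. if i = 0 then 1 else 0 :: 'a"
  have S: "socle_degree n K > 0"
    by (rule socle_degree_pos) fact
  have e: "?e \<in> box n (K(0 := {1}))"
    using subfield by (auto simp: box_def subfield_zero)
  have "(\<Sum>x\<in>box n (K(0 := {1})). f x) = f ?e"
  proof -
    have "(\<Sum>x\<in>box n (K(0 := {1})). f x) = (\<Sum>x\<in>{?e}. f x)"
    proof (rule sum.mono_neutral_right[OF finite_box])
      show "\<forall>x\<in>box n (K(0 := {1})) - {?e}. f x = 0"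
      proof
        fix x assume x: "x \<in> box n (K(0 := {1})) - {?e}"
        then have "x \<in> normal_vecs n K"
          using subfield_one[OF subfield[of 0]]
          by (auto simp: normal_vecs_def box_def split: if_splits intro!: exI[of _ 0])
        then show "f x = 0" using van x by blast
      qed
    qed (use e in auto)
    then show ?thesis by simp
  qed
  moreover have "(\<Sum>x\<in>box n (K(0 := {0})). f x) = 0"
  proof (rule sum.neutral, intro ballI)
    fix x assume x: "x \<in> box n (K(0 := {0}))"
    then have x0: "x 0 = 0" and xK: "x \<in> box n K"
      using subfield_zero[OF subfield[of 0]] by (auto simp: box_def split: if_splits)
    show "f x = 0"
    proof (cases "\<exists>i\<le>n. x i \<noteq> 0")
      case False
      then show ?thesis by (intro form_funs_at_zero[OF f S]) blast
    next
      case True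
      then obtain c Q where cQ: "c \<noteq> 0" "Q \<in> normal_vecs n K" "x = (\<lambda>i. c * Q i)"
        using xK by (auto elim: box_normalise)
      then have "Q \<noteq> ?e" using x0 by (auto dest: fun_cong[of _ _ 0])
      then have "f Q = 0" using van cQ(2) by blast
      then show ?thesis using form_funs_homogeneous[OF f, of c Q] cQ(3) by simp
    qed
  qed
  ultimately show ?thesis using box_sum_slices[OF f] by simp
qed

end

section \<open>The Hilbert function as the rank of evaluation\<close>

text \<open>Over a finite field the dimension of a space can be read off its number of elements.\<close>

context
  fixes N :: "(nat \<Rightarrow> 'a::{field,finite}) set" and n d :: nat
  assumes finN: "finite N"
begin

text \<open>Restriction places the values in \<open>N \<rightarrow>\<^sub>E UNIV\<close>, whose
  cardinality is a power of that of the field.\<close>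

definition eval_on :: "'a mpoly \<Rightarrow> (nat \<Rightarrow> 'a) \<Rightarrow> 'a" where
  "eval_on f = restrict (eval_poly f) N"

definition vanishing_forms :: "'a mpoly set" where
  "vanishing_forms = {f \<in> forms n d. \<forall>a\<in>N. eval_poly f a = 0}"

text \<open>The part of \<open>basis_mod\<close> without spanning; a set of maximal size with this
  property will be a basis.\<close>

definition independent_mod :: "'a mpoly set \<Rightarrow> bool" where
  "independent_mod B \<longleftrightarrow> finite B \<and> B \<subseteq> forms n d \<and>
    (\<forall>u. (\<Sum>b\<in>B. scale_poly (u b) b) \<in> vanishing_forms \<longrightarrow> (\<forall>b\<in>B. u b = 0))"

lemma forms_combination: "B \<subseteq> forms n d \<Longrightarrow> (\<Sum>b\<in>B. scale_poly (u b) b) \<in> forms n d"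
  by (rule forms_sum) (auto intro: forms_scale)

lemma eval_poly_combination:
  "eval_poly (\<Sum>b\<in>B. scale_poly (u b) b) a = (\<Sum>b\<in>B. u b * eval_poly b a)"
  by (simp add: eval_poly_sum)

lemma independent_mod_inj:
  assumes "independent_mod B"
  shows "inj_on (\<lambda>u. eval_on (\<Sum>b\<in>B. scale_poly (u b) b)) (B \<rightarrow>\<^sub>E UNIV)"
proof (rule inj_onI)
  fix u v :: "'a mpoly \<Rightarrow> 'a"
  assume u: "u \<in> B \<rightarrow>\<^sub>E UNIV" and v: "v \<in> B \<rightarrow>\<^sub>E UNIV"
    and eq: "eval_on (\<Sum>b\<in>B. scale_poly (u b) b) = eval_on (\<Sum>b\<in>B. scale_poly (v b) b)"
  have "(\<Sum>b\<in>B. u b * eval_poly b a) = (\<Sum>b\<in>B. v b * eval_poly b a)" if "a \<in> N" for a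
    using fun_cong[OF eq, of a] that by (simp add: eval_on_def eval_poly_combination)
  then have "(\<Sum>b\<in>B. scale_poly (u b - v b) b) \<in> vanishing_forms"
    using assms by (simp add: vanishing_forms_def forms_combination independent_mod_def
        eval_poly_combination left_diff_distrib sum_subtractf)
  then have "\<forall>b\<in>B. u b - v b = 0"
    using assms unfolding independent_mod_def by (elim conjE allE[of _ "\<lambda>b. u b - v b"]) simp
  then show "u = v"
    using u v by (intro PiE_ext[of u B "\<lambda>_. UNIV"]) auto
qed

lemma eval_on_image_subset: "eval_on ` A \<subseteq> N \<rightarrow>\<^sub>E UNIV"
  by (auto simp: eval_on_def)

lemma card_field_gt_1: "card (UNIV :: 'a set) > 1"
proof -
  have "card {0, 1 :: 'a} \<le> card (UNIV :: 'a set)"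
    by (intro card_mono) auto
  then show ?thesis by simp
qed

text \<open>Coefficient vectors inject into functions on \<open>N\<close>, and the exponents of the
  two cardinalities are compared. The bound guarantees that a largest independent set
  exists.\<close>

lemma independent_mod_card_le:
  assumes "independent_mod B"
  shows "card B \<le> card N"
proof -
  have "card (UNIV :: 'a set) ^ card B = card (B \<rightarrow>\<^sub>E (UNIV :: 'a set))"
    using assms by (simp add: card_funcsetE independent_mod_def)
  also have "\<dots> \<le> card (N \<rightarrow>\<^sub>E (UNIV :: 'a set))"
    by (rule card_inj_on_le[OF independent_mod_inj[OF assms]])
       (auto simp: eval_on_def finite_PiE finN)
  also have "\<dots> = card (UNIV :: 'a set) ^ card N"
    by (simp add: card_funcsetE finN)
  finally show ?thesis
    using card_field_gt_1 by simp
qed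

text \<open>In an independent set of maximal size, adjoining a new form \<open>v\<close> creates a
  relation that can be solved for \<open>v\<close>.\<close>

lemma basis_mod_exists: "\<exists>B. basis_mod scale_poly (forms n d) vanishing_forms B"
proof -
  have "independent_mod {}"
    by (simp add: independent_mod_def)
  then obtain B where B: "independent_mod B" and max: "\<And>B'. independent_mod B' \<Longrightarrow> card B' \<le> card B"
    using ex_has_greatest_nat[of independent_mod "{}" card "Suc (card N)"] independent_mod_card_le
    by (metis less_Suc_eq_le)
  have fin: "finite B" and sub: "B \<subseteq> forms n d"
    using B by (auto simp: independent_mod_def)
  have "\<exists>u. v - (\<Sum>b\<in>B. scale_poly (u b) b) \<in> vanishing_forms" if v: "v \<in> forms n d" for v
  proof -
    have eval_minus: "eval_poly (v - g) a = eval_poly v a - eval_poly g a" for g a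
      using eval_poly_add[of "v - g" g a] by (simp add: algebra_simps)
    have form_minus: "v - g \<in> forms n d" if "g \<in> forms n d" for g
    proof -
      have "v - g = v + scale_poly (-1) g"
        by (simp add: scale_poly_def single_uminus)
      then show ?thesis using forms_add[OF v forms_scale[OF that]] by (simp only:)
    qed
    show ?thesis
    proof (cases "v \<in> B")
      case True
      have "eval_poly v a - (\<Sum>b\<in>B. (if b = v then 1 else 0) * eval_poly b a) = 0" for a
        using True fin by (simp add: if_distrib[of "\<lambda>x. x * _"] cong: if_cong)
      then have "v - (\<Sum>b\<in>B. scale_poly (if b = v then 1 else 0) b) \<in> vanishing_forms"
        by (simp add: vanishing_forms_def form_minus forms_combination[OF sub] eval_minus
            eval_poly_combination del: mult_1 mult_zero_left)
      then show ?thesis by (intro exI[of _ "\<lambda>b. if b = v then 1 else 0"])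
    next
      case False
      then have "\<not> independent_mod (insert v B)"
        using max[of "insert v B"] fin by auto
      then obtain u b where u: "(\<Sum>b\<in>insert v B. scale_poly (u b) b) \<in> vanishing_forms"
          and b: "b \<in> insert v B" "u b \<noteq> 0"
        using fin sub v unfolding independent_mod_def by blast
      have ev: "u v * eval_poly v a + (\<Sum>b\<in>B. u b * eval_poly b a) = 0" if "a \<in> N" for a
        using u that False fin
        by (simp add: vanishing_forms_def eval_poly_combination del: sum.insert)
           (simp add: sum.insert)
      \<comment> \<open>Otherwise the relation would involve \<open>B\<close> alone and contradict
        its independence.\<close>
      have "u v \<noteq> 0"
      proof
        assume uv: "u v = 0"
        then have "(\<Sum>b\<in>B. scale_poly (u b) b) \<in> vanishing_forms"
          using ev by (simp add: vanishing_forms_def forms_combination[OF sub] eval_poly_combination)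
        then have "\<forall>b\<in>B. u b = 0"
          using B by (simp add: independent_mod_def)
        then show False using b uv by auto
      qed
      have "eval_poly v a - (\<Sum>b\<in>B. (- u b / u v) * eval_poly b a) = 0" if "a \<in> N" for a
      proof -
        have eq: "(\<Sum>b\<in>B. (- u b / u v) * eval_poly b a) = - (\<Sum>b\<in>B. u b * eval_poly b a) / u v"
          by (simp add: sum_divide_distrib sum_negf)
        show ?thesis
          unfolding eq using ev[OF that] \<open>u v \<noteq> 0\<close> by (simp add: field_simps)
      qed
      then have "v - (\<Sum>b\<in>B. scale_poly (- u b / u v) b) \<in> vanishing_forms"
        by (simp add: vanishing_forms_def form_minus forms_combination[OF sub] eval_minus
            eval_poly_combination)
      then show ?thesis by (intro exI[of _ "\<lambda>b. - u b / u v"])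
    qed
  qed
  then show ?thesis
    using B unfolding basis_mod_def independent_mod_def by blast
qed

lemma basis_mod_card:
  assumes "basis_mod scale_poly (forms n d) vanishing_forms B"
  shows "card (eval_on ` forms n d) = card (UNIV :: 'a set) ^ card B"
proof -
  have B: "independent_mod B"
    using assms by (auto simp: basis_mod_def independent_mod_def)
  then have fin: "finite B" and sub: "B \<subseteq> forms n d"
    by (auto simp: independent_mod_def)
  have "(\<lambda>u. eval_on (\<Sum>b\<in>B. scale_poly (u b) b)) ` (B \<rightarrow>\<^sub>E UNIV) = eval_on ` forms n d"
  proof (intro equalityI subsetI)
    fix y assume "y \<in> eval_on ` forms n d"
    then obtain v where v: "v \<in> forms n d" "y = eval_on v" by blast
    then obtain u where u: "v - (\<Sum>b\<in>B. scale_poly (u b) b) \<in> vanishing_forms"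
      using assms unfolding basis_mod_def by blast
    have "eval_poly v a = eval_poly (\<Sum>b\<in>B. scale_poly (u b) b) a" if "a \<in> N" for a
      using u that eval_poly_add[of "v - (\<Sum>b\<in>B. scale_poly (u b) b)" "\<Sum>b\<in>B. scale_poly (u b) b" a]
      by (simp add: vanishing_forms_def)
    then have "y = eval_on (\<Sum>b\<in>B. scale_poly (u b) b)"
      unfolding v(2) eval_on_def by (rule restrict_ext)
    \<comment> \<open>Restricting the coefficients to \<open>B\<close> keeps the sum and makes them
      a member of \<open>B \<rightarrow>\<^sub>E UNIV\<close>.\<close>
    also have "(\<Sum>b\<in>B. scale_poly (u b) b) = (\<Sum>b\<in>B. scale_poly (restrict u B b) b)"
      by (rule sum.cong) auto
    finally have "y = eval_on (\<Sum>b\<in>B. scale_poly (restrict u B b) b)" .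
    then show "y \<in> (\<lambda>u. eval_on (\<Sum>b\<in>B. scale_poly (u b) b)) ` (B \<rightarrow>\<^sub>E UNIV)"
      by (intro image_eqI[of _ _ "restrict u B"]) auto
  qed (use forms_combination[OF sub] in auto)
  then have "card (eval_on ` forms n d) = card (B \<rightarrow>\<^sub>E (UNIV :: 'a set))"
    using card_image[OF independent_mod_inj[OF B]] by simp
  then show ?thesis
    by (simp add: card_funcsetE fin)
qed

text \<open>Any two bases yield the same power of the field size, hence have equal size; this
  justifies the definite description in \<open>quotient_dim\<close>.\<close>

lemma card_eval_on_image:
  "card (eval_on ` forms n d) = card (UNIV :: 'a set) ^ quotient_dim scale_poly (forms n d) vanishing_forms"
proof -
  obtain B where B: "basis_mod scale_poly (forms n d) vanishing_forms B"
    using basis_mod_exists by blast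
  have "card B' = card B" if "basis_mod scale_poly (forms n d) vanishing_forms B'" for B'
    using basis_mod_card[OF that] basis_mod_card[OF B] card_field_gt_1 by simp
  then have "quotient_dim scale_poly (forms n d) vanishing_forms = card B"
    unfolding quotient_dim_def by (intro the_equality) (use B in blast)+
  then show ?thesis using basis_mod_card[OF B] by simp
qed

lemma quotient_dim_eq_card_iff:
  "quotient_dim scale_poly (forms n d) vanishing_forms = card N \<longleftrightarrow>
    (\<forall>g. \<exists>f\<in>form_funs n d. \<forall>a\<in>N. f a = g a)"
proof -
  have "quotient_dim scale_poly (forms n d) vanishing_forms = card N \<longleftrightarrow>
      card (eval_on ` forms n d) = card (N \<rightarrow>\<^sub>E (UNIV :: 'a set))"
    using card_field_gt_1 by (simp add: card_eval_on_image card_funcsetE finN)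
  also have "\<dots> \<longleftrightarrow> eval_on ` forms n d = N \<rightarrow>\<^sub>E UNIV"
    using card_subset_eq[OF _ eval_on_image_subset] finN by (auto simp: finite_PiE)
  also have "\<dots> \<longleftrightarrow> (\<forall>g. \<exists>f\<in>form_funs n d. \<forall>a\<in>N. f a = g a)"
  proof
    assume eq: "eval_on ` forms n d = N \<rightarrow>\<^sub>E UNIV"
    show "\<forall>g. \<exists>f\<in>form_funs n d. \<forall>a\<in>N. f a = g a"
    proof
      fix g :: "(nat \<Rightarrow> 'a) \<Rightarrow> 'a"
      have "restrict g N \<in> eval_on ` forms n d"
        unfolding eq by simp
      then obtain p where "p \<in> forms n d" "restrict g N = eval_on p" by blast
      then show "\<exists>f\<in>form_funs n d. \<forall>a\<in>N. f a = g a"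
        by (auto simp: form_funs_def eval_on_def restrict_def fun_eq_iff intro!: bexI[of _ p])
           metis
    qed
  next
    assume surj: "\<forall>g. \<exists>f\<in>form_funs n d. \<forall>a\<in>N. f a = g a"
    show "eval_on ` forms n d = N \<rightarrow>\<^sub>E UNIV"
    proof (intro equalityI eval_on_image_subset subsetI)
      fix g :: "(nat \<Rightarrow> 'a) \<Rightarrow> 'a" assume g: "g \<in> N \<rightarrow>\<^sub>E UNIV"
      obtain p where p: "p \<in> forms n d" "\<forall>a\<in>N. eval_poly p a = g a"
        using surj by (auto simp: form_funs_def)
      then have "g = eval_on p"
        using g by (auto simp: eval_on_def PiE_def extensional_def fun_eq_iff)
      then show "g \<in> eval_on ` forms n d" using p(1) by blast
    qed
  qed
  finally show ?thesis .
qed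

end

section \<open>From projective points to normalised representatives\<close>

definition proj_point :: "nat \<Rightarrow> (nat \<Rightarrow> 'a::field) \<Rightarrow> (nat \<Rightarrow> 'a) set" where
  "proj_point n a = proj_rel n `` {a}"

lemma proj_point_in_space: "a \<in> nonzero_vecs n \<Longrightarrow> proj_point n a \<in> proj_space n"
  by (auto simp: proj_point_def proj_space_def intro: quotientI)

lemma mem_proj_point_self: "a \<in> nonzero_vecs n \<Longrightarrow> a \<in> proj_point n a"
  by (auto simp: proj_point_def proj_rel_def intro!: exI[of _ 1])

lemma equiv_proj_rel: "equiv (nonzero_vecs n) (proj_rel n)" (is "equiv ?A ?r")
proof (rule equivI)
  show "sym ?r"
  proof (rule symI)
    fix a b :: "nat \<Rightarrow> 'a" assume "(a, b) \<in> proj_rel n"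
    then obtain c where "c \<noteq> 0" "\<forall>i. b i = c * a i" "a \<in> nonzero_vecs n" "b \<in> nonzero_vecs n"
      by (auto simp: proj_rel_def)
    then show "(b, a) \<in> proj_rel n"
      by (auto simp: proj_rel_def intro!: exI[of _ "inverse c"])
  qed
  show "trans ?r"
  proof (rule transI)
    fix a b e :: "nat \<Rightarrow> 'a" assume "(a, b) \<in> proj_rel n" "(b, e) \<in> proj_rel n"
    then obtain c c' where "c \<noteq> 0" "\<forall>i. b i = c * a i" "c' \<noteq> 0" "\<forall>i. e i = c' * b i"
        "a \<in> nonzero_vecs n" "e \<in> nonzero_vecs n"
      by (auto simp: proj_rel_def)
    then show "(a, e) \<in> proj_rel n"
      by (auto simp: proj_rel_def intro!: exI[of _ "c' * c"])
  qed
  show "?r \<subseteq> ?A \<times> ?A"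
    by (auto simp: proj_rel_def)
  show "refl_on ?A ?r"
    by (auto simp: refl_on_def proj_rel_def intro!: exI[of _ 1])
qed

lemma vanishes_at_proj_point:
  assumes "f \<in> forms n d" "a \<in> nonzero_vecs n"
  shows "vanishes_at f (proj_point n a) \<longleftrightarrow> eval_poly f a = 0"
proof
  assume "eval_poly f a = 0"
  show "vanishes_at f (proj_point n a)"
    unfolding vanishes_at_def
  proof
    fix b assume "b \<in> proj_point n a"
    then obtain c where "b = (\<lambda>i. c * a i)"
      by (auto simp: proj_point_def proj_rel_def fun_eq_iff)
    then show "eval_poly f b = 0"
      using forms_eval_scale[OF assms(1)] \<open>eval_poly f a = 0\<close> by simp
  qed
qed (use mem_proj_point_self[OF assms(2)] in \<open>auto simp: vanishes_at_def\<close>)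

lemma normal_vecs_nonzero: "normal_vecs n K \<subseteq> nonzero_vecs n"
  by (auto simp: normal_vecs_def box_def nonzero_vecs_def intro!: exI[of _ "_ :: nat"])

text \<open>Proportional vectors have the same first nonzero index, and the leading \<open>1\<close>
  there forces the scalar to be \<open>1\<close>.\<close>

lemma inj_on_proj_point: "inj_on (proj_point n) (normal_vecs n K)"
proof (rule inj_onI)
  fix a b assume a: "a \<in> normal_vecs n K" and b: "b \<in> normal_vecs n K"
    and "proj_point n a = proj_point n b"
  then have "b \<in> proj_point n a"
    using mem_proj_point_self[of b n] normal_vecs_nonzero[of n K] by auto
  then obtain c where c: "c \<noteq> 0" "\<And>i. b i = c * a i"
    by (auto simp: proj_point_def proj_rel_def)
  obtain k where k: "a k = 1" "\<And>i. i < k \<Longrightarrow> a i = 0"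
    using a by (auto simp: normal_vecs_def)
  obtain j where j: "b j = 1" "\<And>i. i < j \<Longrightarrow> b i = 0"
    using b by (auto simp: normal_vecs_def)
  have "j = k"
    using c(1) c(2)[of j] c(2)[of k] j k by (cases j k rule: linorder_cases) auto
  then have "c = 1" using c(2)[of k] j(1) k(1) by simp
  then show "a = b" using c(2) by (simp add: fun_eq_iff)
qed

text \<open>The polynomials vanishing at all representatives of all points form an ideal that
  contains the generators, so passing to the hull adds no form beyond the vanishing ones.\<close>

lemma vanishing_ideal_forms:
  "vanishing_ideal n X \<inter> forms n d = {f \<in> forms n d. \<forall>P\<in>X. vanishes_at f P}"
proof (intro equalityI subsetI)
  fix f assume f: "f \<in> vanishing_ideal n X \<inter> forms n d"
  define J where "J = {f \<in> poly_ring n. \<forall>P\<in>X. vanishes_at f P}"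
  have "is_ideal n J"
    by (auto simp: is_ideal_def J_def vanishes_at_def poly_ring_add poly_ring_mult)
       (simp add: poly_ring_def)
  then have "vanishing_ideal n X \<subseteq> J"
    unfolding vanishing_ideal_def by (intro hull_minimal) (auto simp: J_def forms_def)
  then show "f \<in> {f \<in> forms n d. \<forall>P\<in>X. vanishes_at f P}"
    using f by (auto simp: J_def)
next
  fix f assume "f \<in> {f \<in> forms n d. \<forall>P\<in>X. vanishes_at f P}"
  then show "f \<in> vanishing_ideal n X \<inter> forms n d"
    by (auto simp: vanishing_ideal_def intro!: hull_inc)
qed

context subfield_tower
begin

lemma proj_nested_eq: "proj_nested n K = proj_point n ` normal_vecs n K"
proof (intro equalityI subsetI)
  fix P assume "P \<in> proj_nested n K"
  then obtain a e where P: "P = proj_point n e" "e \<in> nonzero_vecs n" and a: "a \<in> P"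
      and aK: "\<forall>i\<le>n. a i \<in> K i"
    by (auto simp: proj_nested_def proj_space_def proj_point_def quotient_def)
  have an: "a \<in> nonzero_vecs n"
    using a P by (auto simp: proj_point_def proj_rel_def)
  have Pa: "P = proj_point n a"
    using a P equiv_class_eq[OF equiv_proj_rel, of e a n] by (auto simp: proj_point_def)
  have "a \<in> box n K" "\<exists>i\<le>n. a i \<noteq> 0"
    using an aK by (auto simp: box_def nonzero_vecs_def)
  then obtain c Q where Q: "c \<noteq> 0" "Q \<in> normal_vecs n K" "a = (\<lambda>i. c * Q i)"
    by (rule box_normalise)
  then have "(Q, a) \<in> proj_rel n"
    using an normal_vecs_nonzero[of n K] by (auto simp: proj_rel_def)
  then have "P = proj_point n Q"
    using Pa equiv_class_eq[OF equiv_proj_rel, of Q a n] by (simp add: proj_point_def)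
  then show "P \<in> proj_point n ` normal_vecs n K"
    using Q(2) by blast
next
  fix P assume "P \<in> proj_point n ` normal_vecs n K"
  then obtain Q where Q: "Q \<in> normal_vecs n K" "P = proj_point n Q" by blast
  then have "Q \<in> nonzero_vecs n"
    using normal_vecs_nonzero by blast
  then show "P \<in> proj_nested n K"
    using Q proj_point_in_space[of Q n] mem_proj_point_self[of Q n]
    by (auto simp: proj_nested_def normal_vecs_def box_def)
qed

lemma hilbert_fun_eq_card_iff:
  "hilbert_fun n (proj_nested n K) d = card (proj_nested n K) \<longleftrightarrow>
    (\<forall>g. \<exists>f\<in>form_funs n d. \<forall>a\<in>normal_vecs n K. f a = g a)"
proof -
  have "vanishing_ideal n (proj_nested n K) \<inter> forms n d = vanishing_forms (normal_vecs n K) n d"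
    unfolding vanishing_ideal_forms proj_nested_eq vanishing_forms_def[OF finite_normal_vecs]
    by (auto simp: vanishes_at_proj_point[OF _ subsetD[OF normal_vecs_nonzero]])
  moreover have "card (proj_nested n K) = card (normal_vecs n K)"
    unfolding proj_nested_eq by (rule card_image[OF inj_on_proj_point])
  ultimately show ?thesis
    using quotient_dim_eq_card_iff[OF finite_normal_vecs, of n d n K]
    by (simp add: hilbert_fun_def)
qed

section \<open>The regularity and the Cayley--Bacharach condition in terms of separators\<close>

lemma hilbert_reg_eq:
  assumes "n \<ge> 1"
  shows "hilbert_reg n (proj_nested n K) = Suc (socle_degree n K)"
  unfolding hilbert_reg_def hilbert_fun_eq_card_iff
proof (rule Least_equality)
  show "\<forall>d\<ge>Suc (socle_degree n K). \<forall>g. \<exists>f\<in>form_funs n d. \<forall>a\<in>normal_vecs n K. f a = g a"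
    using interpolation[OF subfield_tower_axioms] by auto
next
  fix r
  assume *: "\<forall>d\<ge>r. \<forall>g. \<exists>f\<in>form_funs n d. \<forall>a\<in>normal_vecs n K. f a = g a"
  let ?e = "\<lambda>i::nat. if i = 0 then 1 else 0 :: 'a"
  have e: "?e \<in> normal_vecs n K"
    using subfield by (auto simp: normal_vecs_def box_def subfield_zero subfield_one)
  show "Suc (socle_degree n K) \<le> r"
  proof (rule ccontr)
    assume "\<not> Suc (socle_degree n K) \<le> r"
    \<comment> \<open>A smaller \<open>r\<close> would allow interpolation in the socle degree, in
      particular of the indicator of the first coordinate point.\<close>
    then obtain f where f: "f \<in> form_funs n (socle_degree n K)"
        "\<And>a. a \<in> normal_vecs n K \<Longrightarrow> f a = (if a = ?e then 1 else 0)"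
      using *[THEN spec, of "socle_degree n K", THEN mp, THEN spec, of "\<lambda>a. if a = ?e then 1 else 0"]
      by (auto simp del: if_split)
    have "f ?e = 0"
      by (rule no_first_point_separator[OF assms f(1)]) (simp only: f(2) if_False)
    then show False using f(2)[OF e] by simp
  qed
qed

lemma cayley_bacharach_iff:
  assumes "n \<ge> 1"
  shows "cayley_bacharach n (proj_nested n K) \<longleftrightarrow>
    (\<forall>d\<le>socle_degree n K. \<forall>f\<in>form_funs n d. \<forall>P\<in>normal_vecs n K.
      (\<forall>Q\<in>normal_vecs n K - {P}. f Q = 0) \<longrightarrow> f P = 0)"
proof -
  have hyp: "proj_point n ` A \<subseteq> hypersurface n p \<longleftrightarrow> (\<forall>a\<in>A. eval_poly p a = 0)"
    if "p \<in> forms n d" "A \<subseteq> normal_vecs n K" for p d A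
  proof -
    have "a \<in> nonzero_vecs n" if "a \<in> A" for a
      using that \<open>A \<subseteq> normal_vecs n K\<close> normal_vecs_nonzero[of n K] by blast
    then show ?thesis
      using \<open>p \<in> forms n d\<close>
      by (auto simp: hypersurface_def vanishes_at_proj_point proj_point_in_space image_subset_iff)
  qed
  have diff: "proj_nested n K - {proj_point n P} = proj_point n ` (normal_vecs n K - {P})"
    if "P \<in> normal_vecs n K" for P
    using inj_on_image_set_diff[OF inj_on_proj_point[of n K], of "normal_vecs n K" "{P}"] that
    by (simp add: proj_nested_eq)
  have "(p \<noteq> 0 \<longrightarrow> (\<forall>P\<in>proj_nested n K. proj_nested n K - {P} \<subseteq> hypersurface n p \<longrightarrow>
        proj_nested n K \<subseteq> hypersurface n p)) \<longleftrightarrow>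
      (\<forall>P\<in>normal_vecs n K. (\<forall>Q\<in>normal_vecs n K - {P}. eval_poly p Q = 0) \<longrightarrow> eval_poly p P = 0)"
    if p: "p \<in> forms n d" for p d
  proof -
    have "(\<forall>P\<in>proj_nested n K. proj_nested n K - {P} \<subseteq> hypersurface n p \<longrightarrow>
        proj_nested n K \<subseteq> hypersurface n p) \<longleftrightarrow>
      (\<forall>P\<in>normal_vecs n K. (\<forall>Q\<in>normal_vecs n K - {P}. eval_poly p Q = 0) \<longrightarrow>
        (\<forall>Q\<in>normal_vecs n K. eval_poly p Q = 0))"
      using diff hyp[OF p] by (simp add: proj_nested_eq)
    also have "\<dots> \<longleftrightarrow> (\<forall>P\<in>normal_vecs n K.
        (\<forall>Q\<in>normal_vecs n K - {P}. eval_poly p Q = 0) \<longrightarrow> eval_poly p P = 0)"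
      by blast
    finally have eq: "(\<forall>P\<in>proj_nested n K. proj_nested n K - {P} \<subseteq> hypersurface n p \<longrightarrow>
        proj_nested n K \<subseteq> hypersurface n p) \<longleftrightarrow> (\<forall>P\<in>normal_vecs n K.
        (\<forall>Q\<in>normal_vecs n K - {P}. eval_poly p Q = 0) \<longrightarrow> eval_poly p P = 0)" .
    \<comment> \<open>If \<open>p\<close> is zero, both sides hold because all its values
      vanish.\<close>
    show ?thesis
      unfolding eq by (cases "p = 0") simp_all
  qed
  then have "cayley_bacharach n (proj_nested n K) \<longleftrightarrow>
    (\<forall>d\<le>socle_degree n K. \<forall>p\<in>forms n d. \<forall>P\<in>normal_vecs n K.
      (\<forall>Q\<in>normal_vecs n K - {P}. eval_poly p Q = 0) \<longrightarrow> eval_poly p P = 0)"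
    unfolding cayley_bacharach_def hilbert_reg_eq[OF assms] less_Suc_eq_le
    by (intro all_cong ball_cong refl)
  then show ?thesis
    unfolding form_funs_def ball_simps .
qed

end

theorem corollary4p11:
  fixes n m :: nat and K :: "nat \<Rightarrow> 'a::{field,finite} set"
  assumes "n \<ge> 1"
    and "\<And>i. i \<le> n \<Longrightarrow> is_subfield (K i)"
    and "\<And>i. i < n \<Longrightarrow> K i \<subseteq> K (Suc i)"
    and "m = (LEAST k. k * (card (K n) - 1) > (\<Sum>i=1..n-1. card (K i) - 1))"
  shows "cayley_bacharach n (proj_nested n K) \<longleftrightarrow>
    (\<Sum>i=1..n. card (K i) - 1) + 1 = m * (card (K n) - 1) + 1"
proof -
  interpret subfield_tower n K
    using assms(2,3) by unfold_locales
  obtain k where n: "n = Suc k"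
    using assms(1) by (cases n) auto
  define q where "q = card (K n) - 1"
  have q: "q > 0"
    using subfield_card_ge_2[OF subfield[of n]] by (simp add: q_def)
  have S: "socle_degree n K = socle_degree k K + q"
    by (simp add: n socle_degree_Suc q_def)
  have m: "m = (LEAST j. j * q > socle_degree k K)"
    using assms(4) by (simp add: n socle_degree_def q_def)
  \<comment> \<open>A witness showing that the set minimised in \<open>m\<close> is
    inhabited.\<close>
  have "Suc (socle_degree k K) * q > socle_degree k K"
    using q by (cases q) auto
  then have m_gt: "m * q > socle_degree k K"
    unfolding m by (rule LeastI)
  then have m_pos: "m > 0" by (cases m) auto
  \<comment> \<open>Minimality of \<open>m\<close>; adding \<open>q\<close> gives
    \<open>m * q \<le> socle_degree n K\<close>, the half of the equality that always holds.\<close>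
  then have "(m - 1) * q \<le> socle_degree k K"
    using not_less_Least[of "m - 1" "\<lambda>j. j * q > socle_degree k K"] m by auto
  then have m_le: "m * q \<le> socle_degree n K"
    using m_pos by (simp add: S algebra_simps)
  have "cayley_bacharach n (proj_nested n K) \<longleftrightarrow> socle_degree n K = m * q"
  proof
    assume "socle_degree n K = m * q"
    then show "cayley_bacharach n (proj_nested n K)"
      unfolding cayley_bacharach_iff[OF assms(1)] q_def
      by (blast intro: no_separator_below_socle_degree[OF assms(1)])
  next
    let ?e = "\<lambda>i::nat. if i = n then 1 else 0 :: 'a"
    assume cb: "cayley_bacharach n (proj_nested n K)"
    have tower: "subfield_tower (Suc k) K" "subfield_tower k K"
      using subfield_tower_axioms subfield_tower_pred by (auto simp: n)
    have e: "?e \<in> normal_vecs n K"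
      using subfield by (auto simp: normal_vecs_def box_def subfield_zero subfield_one)
    obtain h where h: "h \<in> form_funs k (m * q)" "\<And>Q. Q \<in> normal_vecs k K \<Longrightarrow> h Q = 1"
      using interpolation[OF tower(2) m_gt, of "\<lambda>_. 1"] by blast
    have "m * q > 0" "m * q = m * (card (K (Suc k)) - 1)"
      using m_pos q by (simp_all add: q_def n)
    from last_point_separator[OF tower(1) this(2,1) h]
    obtain f where f: "f \<in> form_funs n (Suc (m * q))"
        "\<And>Q. Q \<in> normal_vecs n K \<Longrightarrow> f Q = (if Q = ?e then 1 else 0)"
      unfolding n by blast
    \<comment> \<open>The last coordinate point has a separator of degree
      \<open>Suc (m * q)\<close>, which the Cayley--Bacharach property forbids up to the socle
      degree.\<close>
    have "\<not> Suc (m * q) \<le> socle_degree n K"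
    proof
      assume "Suc (m * q) \<le> socle_degree n K"
      moreover have "\<forall>Q\<in>normal_vecs n K - {?e}. f Q = 0"
        using f(2) by (simp del: if_split)
      ultimately have "f ?e = 0"
        using cb[unfolded cayley_bacharach_iff[OF assms(1)]] f(1) e by blast
      then show False using f(2)[OF e] by simp
    qed
    then show "socle_degree n K = m * q" using m_le by simp
  qed
  then show ?thesis by (simp add: socle_degree_def q_def)
qed

end
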